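(* Let $L_1,\dots,L_k\subseteq\Sigma$ be $k$ sets with $n_i=|L_i|$ and $n_1\le n_2\le\dots\le n_k$, let $n=\sum_{i=1}^k n_i$ and $r=\left|\bigcap_{i=1}^k L_i\right|$, and suppose the sets have been pre-processed as described in the context. With $t_i=\lceil\log(n_i/\sqrt w)\rceil$ for $i=1,\dots,k$, the $k$-set randomized-partition intersection algorithm described in the context (Algorithm 4) computes $\bigcap_{i=1}^k L_i$ in expected time $$\mathbf{O}\left(\frac{n}{\sqrt w}+kr\right).$$
   Context: Model and notation: $w$ is the number of bits of a machine word; arithmetic and bitwise operations on words take $O(1)$ time; $\log=\log_2$; $[w]=\{1,\dots,w\}$. A subset $A\subseteq[w]$ is stored as one machine word whose $y$-th bit is $1$ iff $y\in A$ (its word representation); thus two such subsets are intersected by one bitwise AND in $O(1)$ time, and the elements of $A$ can be listed in $O(|A|)$ time. $\Sigma$ is the universe of elements, each fitting in a machine word. Hash functions: $g:\Sigma\to\{0,1\}^w$ is a random hash function from a 2-universal (pairwise independent) family (or a random permutation of $\Sigma=\{0,1\}^w$); $g_t(x)$ denotes the $t$ most significant bits of $g(x)$. Independently of $g$, $h:\Sigma\to[w]$ is a random function from a universal family, i.e. $\Pr[h(x)=h(x')]\le 1/w$ for $x\ne x'$. The same $g,h$ are used for all sets. Expectation is over $g$ and $h$. A bit string $z_1$ is the $t_1$-prefix of $z_2$ if $z_1$ equals the highest $t_1$ bits of $z_2$. The $t_i$ are required to be nonnegative. Pre-processing: each $L_i$ is partitioned into the groups $L_i^z=\{x\in L_i: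 g_{t_i}(x)=z\}$, $z\in\{0,1\}^{t_i}$. For each group one stores the word representation of $h(L_i^z)=\{h(x):x\in L_i^z\}$, and for each $y\in[w]$ the inverted mapping $h^{-1}(y,L_i^z)=\{x\in L_i^z: h(x)=y\}$ can be listed in time linear in its size, in an order consistent across all sets and groups. Pre-processing time is not counted. Algorithm 4: for each $z_k\in\{0,1\}^{t_k}$, let $z_i$ be the $t_i$-prefix of $z_k$ for $i=1,\dots,k-1$; compute $\bigcap_{i=1}^k L_i^{z_i}$ and add it to the output. Each $\bigcap_{i=1}^k L_i^{z_i}$ is computed by (extended IntersectSmall): first compute $H=\bigcap_{i=1}^k h(L_i^{z_i})$ by bitwise AND of word representations; then, for each $y\in H$, compute $\bigcap_{i=1}^k h^{-1}(y,L_i^{z_i})$; the union of these over $y\in H$ is $\bigcap_{i=1}^k L_i^{z_i}$. In the implementation, partial results are memorized and reused: the partial intersections $\bigcap_{i=1}^j h(L_i^{z_i})$ are computed once for each $z_j$ and shared among all $z_k$ having $z_j$ as prefix, and the intersections of inverted mappings are computed in the order $i=k,k-1,\dots,1$ with memorized partial results $\bigcap_{i=j}^k h^{-1}(y,L_i^{z_i})$, using hash-table-based intersection. *)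

theory Defs
  imports "HOL-Probability.Probability" "HOL-Combinatorics.Permutations" "HOL-Library.Monad_Syntax"
begin

section \<open>Computations with a step count\<close>

text \<open>
  A computation is a result together with the number of machine steps spent on it.
  Steps are charged only by the primitives below and by the loop combinators: every primitive
  that the machine model executes in constant time costs one step, and a primitive that produces
  a list costs one step plus one step per list entry.  Replacing these unit costs by other
  constants changes the running time by at most a constant factor.
\<close>

datatype 'a timed = Timed (result: 'a) (steps: nat)

definition bind_timed :: "'a timed \<Rightarrow> ('a \<Rightarrow> 'b timed) \<Rightarrow> 'b timed" where
  "bind_timed m f = Timed (result (f (result m))) (steps m + steps (f (result m)))"

adhoc_overloading Monad_Syntax.bind \<rightleftharpoons> bind_timed

definition return_timed :: "'a \<Rightarrow> 'a timed" where
  "return_timed v = Timed v 0"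

definition unit_cost :: "'a \<Rightarrow> 'a timed" where
  "unit_cost v = Timed v 1"

definition list_cost :: "'a list \<Rightarrow> 'a list timed" where
  "list_cost xs = Timed xs (1 + length xs)"

primrec timed_map :: "('a \<Rightarrow> 'b timed) \<Rightarrow> 'a list \<Rightarrow> 'b list timed" where
  "timed_map f [] = unit_cost []"
| "timed_map f (x # xs) =
     do { v \<leftarrow> f x; vs \<leftarrow> timed_map f xs; unit_cost (v # vs) }"

primrec timed_filter :: "('a \<Rightarrow> bool timed) \<Rightarrow> 'a list \<Rightarrow> 'a list timed" where
  "timed_filter p [] = unit_cost []"
| "timed_filter p (x # xs) =
     do { b \<leftarrow> p x; ys \<leftarrow> timed_filter p xs; unit_cost (if b then x # ys else ys) }"

text \<open>Appending the output \<open>ys\<close> of one iteration is charged \<open>1 + length ys\<close>.\<close>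

primrec timed_concat_map :: "('a \<Rightarrow> 'b list timed) \<Rightarrow> 'a list \<Rightarrow> 'b list timed" where
  "timed_concat_map f [] = unit_cost []"
| "timed_concat_map f (x # xs) =
     do { ys \<leftarrow> f x; ys' \<leftarrow> list_cost ys; zs \<leftarrow> timed_concat_map f xs; return_timed (ys' @ zs) }"


section \<open>Words and prefixes\<close>

text \<open>
  Machine words, and likewise bit strings of a known length \<open>t\<close>, are numbers below \<open>2 ^ w\<close>
  (below \<open>2 ^ t\<close>).  The elements of \<open>[w]\<close> are \<open>1, \<dots>, w\<close>, and \<open>y \<in> [w]\<close> is stored in the
  bit of weight \<open>2 ^ (y - 1)\<close>.
\<close>

definition word_rep :: "nat set \<Rightarrow> nat" where
  "word_rep A = (\<Sum>y\<in>A. 2 ^ (y - 1))"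

definition word_elems :: "nat \<Rightarrow> nat \<Rightarrow> nat list" where
  "word_elems w W = filter (\<lambda>y. bit W (y - 1)) [1..<Suc w]"

text \<open>The \<open>t\<close> most significant bits of a bit string \<open>z\<close> of length \<open>t'\<close>, for \<open>t \<le> t'\<close>.\<close>

definition top_bits :: "nat \<Rightarrow> nat \<Rightarrow> nat \<Rightarrow> nat" where
  "top_bits t t' z = drop_bit (t' - t) z"


section \<open>Random hash functions\<close>

definition pairwise_independent_family :: "nat set \<Rightarrow> nat \<Rightarrow> (nat \<Rightarrow> nat) pmf \<Rightarrow> bool" where
  "pairwise_independent_family U w G \<longleftrightarrow>
     (\<forall>x\<in>U. map_pmf (\<lambda>g. g x) G = pmf_of_set {..<2 ^ w}) \<and>
     (\<forall>x\<in>U. \<forall>x'\<in>U. x \<noteq> x' \<longrightarrow>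
        map_pmf (\<lambda>g. (g x, g x')) G = pair_pmf (pmf_of_set {..<2 ^ w}) (pmf_of_set {..<2 ^ w}))"

definition random_permutation :: "nat set \<Rightarrow> nat \<Rightarrow> (nat \<Rightarrow> nat) pmf \<Rightarrow> bool" where
  "random_permutation U w G \<longleftrightarrow> U = {..<2 ^ w} \<and> G = pmf_of_set {g. g permutes U}"

definition universal_family :: "nat set \<Rightarrow> nat \<Rightarrow> (nat \<Rightarrow> nat) pmf \<Rightarrow> bool" where
  "universal_family U w H \<longleftrightarrow>
     (\<forall>h\<in>set_pmf H. \<forall>x\<in>U. h x \<in> {1..w}) \<and>
     (\<forall>x\<in>U. \<forall>x'\<in>U. x \<noteq> x' \<longrightarrow> measure_pmf.prob H {h. h x = h x'} \<le> 1 / real w)"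


section \<open>Pre-processing\<close>

text \<open>
  The number of bits \<open>t\<^sub>i\<close> for a set of size \<open>m\<close>.  It is an integer because it may be
  negative; it has its intended meaning only for \<open>m > 0\<close>.
\<close>

definition partition_bits :: "nat \<Rightarrow> nat \<Rightarrow> int" where
  "partition_bits w m = \<lceil>log 2 (real m / sqrt (real w))\<rceil>"

definition hash_group :: "nat \<Rightarrow> (nat \<Rightarrow> nat) \<Rightarrow> nat set \<Rightarrow> nat \<Rightarrow> nat \<Rightarrow> nat set" where
  "hash_group w g A t z = {x \<in> A. top_bits t w (g x) = z}"

text \<open>
  The stored data, indexed by the number \<open>i\<close> of the set, the string \<open>z\<close> of the group and, for the
  inverted mapping, the hash value \<open>y\<close>.
\<close>

record preprocessed =
  len :: "nat \<Rightarrow> nat"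
  hash_word :: "nat \<Rightarrow> nat \<Rightarrow> nat"
  inverted :: "nat \<Rightarrow> nat \<Rightarrow> nat \<Rightarrow> nat list"

text \<open>
  The injective function \<open>key\<close> fixes the common order in which all inverted mappings are listed.
\<close>

definition preprocess ::
    "nat \<Rightarrow> (nat \<Rightarrow> nat) \<Rightarrow> (nat \<Rightarrow> nat set) \<Rightarrow> (nat \<Rightarrow> nat) \<Rightarrow> (nat \<Rightarrow> nat) \<Rightarrow> preprocessed" where
  "preprocess w key L g h =
     (let t = (\<lambda>i. nat (partition_bits w (card (L i)))) in
      \<lparr> len = t,
        hash_word = (\<lambda>i z. word_rep (h ` hash_group w g (L i) (t i) z)),
        inverted = (\<lambda>i z y.
          sort_key key (sorted_list_of_set {x \<in> hash_group w g (L i) (t i) z. h x = y})) \<rparr>)"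


section \<open>The intersection algorithm\<close>

text \<open>
  The table of the words of \<open>h(L\<^sub>1\<^bsup>z1\<^esup>) \<inter> \<dots> \<inter> h(L\<^sub>j\<^bsup>zj\<^esup>)\<close> for all strings \<open>z\<^sub>j\<close> of length
  \<open>t\<^sub>j\<close>, computed from the table for \<open>j - 1\<close>.  The lists are used as arrays: entry \<open>z\<close> is
  accessed in one step.
\<close>

fun and_table :: "preprocessed \<Rightarrow> nat \<Rightarrow> nat list timed" where
  "and_table D 0 = return_timed []"
| "and_table D (Suc 0) = timed_map (\<lambda>z. unit_cost (hash_word D 1 z)) [0..<2 ^ len D 1]"
| "and_table D (Suc (Suc j)) =
     do {
       T \<leftarrow> and_table D (Suc j);
       timed_map (\<lambda>z. do {
           z' \<leftarrow> unit_cost (top_bits (len D (Suc j)) (len D (Suc (Suc j))) z);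
           W \<leftarrow> unit_cost (T ! z');
           V \<leftarrow> unit_cost (hash_word D (Suc (Suc j)) z);
           unit_cost (Bit_Operations.and W V)
         }) [0..<2 ^ len D (Suc (Suc j))]
     }"

text \<open>
  Hash-table-based intersection of a list with \<open>h\<^sup>-\<^sup>1(y, L\<^sub>i\<^sup>z)\<close>: each inverted mapping comes with
  a hash table, in which a membership query takes one step.
\<close>

definition hash_intersect ::
    "preprocessed \<Rightarrow> nat \<Rightarrow> nat \<Rightarrow> nat \<Rightarrow> nat list \<Rightarrow> nat list timed" where
  "hash_intersect D i z y P = timed_filter (\<lambda>x. unit_cost (x \<in> set (inverted D i z y))) P"

text \<open>
  Given the partial result \<open>P\<close> for the sets \<open>i + 1, \<dots>, k\<close>, intersect it with the inverted
  mappings for \<open>i, \<dots>, 1\<close>, in this order.  An empty partial result is final, so the remaining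
  sets are not visited.
\<close>

primrec intersect_down ::
    "preprocessed \<Rightarrow> nat \<Rightarrow> nat \<Rightarrow> nat \<Rightarrow> nat \<Rightarrow> nat list \<Rightarrow> nat list timed" where
  "intersect_down D k z y 0 P = unit_cost P"
| "intersect_down D k z y (Suc i) P =
     (if P = [] then unit_cost []
      else do {
        z' \<leftarrow> unit_cost (top_bits (len D (Suc i)) (len D k) z);
        P' \<leftarrow> hash_intersect D (Suc i) z' y P;
        intersect_down D k z y i P'
      })"

definition intersect_groups :: "nat \<Rightarrow> preprocessed \<Rightarrow> nat \<Rightarrow> nat \<Rightarrow> nat \<Rightarrow> nat list timed" where
  "intersect_groups w D k z W =
     do {
       ys \<leftarrow> list_cost (word_elems w W);
       timed_concat_map (\<lambda>y. do {
           P \<leftarrow> list_cost (inverted D k z y);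
           intersect_down D k z y (k - 1) P
         }) ys
     }"

definition intersect_sets :: "nat \<Rightarrow> preprocessed \<Rightarrow> nat \<Rightarrow> nat list timed" where
  "intersect_sets w D k =
     do {
       T \<leftarrow> and_table D k;
       timed_concat_map (\<lambda>z. do {
           W \<leftarrow> unit_cost (T ! z);
           intersect_groups w D k z W
         }) [0..<2 ^ len D k]
     }"

end

theory Submission
  imports Defs
begin

text \<open>
  Write \<open>z\<^sub>i(x)\<close> for the string of the group of \<open>L\<^sub>i\<close> that \<open>x\<close> belongs to, or would belong to if it
  were an element.  Building the tables costs \<open>O(\<Sum> 2\<^bsup>t\<^esup>) = O(n/sqrt w)\<close>.  All remaining work is charged to
  the elements \<open>x \<in> L\<^sub>k\<close> whose hash value \<open>h(x)\<close> occurs in every group \<open>L\<^sub>i\<^bsup>z(x)\<^esup>\<close>: each nonempty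
  partial result pays for one step of the descending intersection, so such an \<open>x\<close> is charged a
  constant times the number of trailing sets \<open>L\<^sub>k, L\<^bsub>k-1\<^esub>, \<dots>\<close> that contain it, which is at most \<open>k\<close>.
  Elements of the intersection thus contribute \<open>O(kr)\<close>.  If \<open>x \<notin> L\<^sub>j\<close> for some \<open>j\<close>, then \<open>x\<close> is charged
  only if it collides under both hash functions with one of the \<open>n\<^sub>j\<close> elements of \<open>L\<^sub>j\<close>, which has
  probability at most \<open>n\<^sub>j * 2\<^bsup>-t\<^esup> * 1/w \<le> 1/sqrt w\<close>; and the numbers of trailing sets sum to at most \<open>n\<close>.
\<close>

section \<open>Loop combinators\<close>

lemma result_bind [simp]: "result (m \<bind> f) = result (f (result m))"
  by (simp add: bind_timed_def)

lemma steps_bind [simp]: "steps (m \<bind> f) = steps m + steps (f (result m))"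
  by (simp add: bind_timed_def)

lemma result_unit_cost [simp]: "result (unit_cost v) = v"
  and steps_unit_cost [simp]: "steps (unit_cost v) = 1"
  by (simp_all add: unit_cost_def)

lemma result_return_timed [simp]: "result (return_timed v) = v"
  and steps_return_timed [simp]: "steps (return_timed v) = 0"
  by (simp_all add: return_timed_def)

lemma result_list_cost [simp]: "result (list_cost xs) = xs"
  and steps_list_cost [simp]: "steps (list_cost xs) = 1 + length xs"
  by (simp_all add: list_cost_def)

lemma result_timed_map: "result (timed_map f xs) = map (\<lambda>x. result (f x)) xs"
  by (induction xs) auto

lemma steps_timed_map: "steps (timed_map f xs) = 1 + (\<Sum>x\<leftarrow>xs. 1 + steps (f x))"
  by (induction xs) auto

lemma result_timed_filter: "result (timed_filter p xs) = filter (\<lambda>x. result (p x)) xs"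
  by (induction xs) auto

lemma steps_timed_filter: "steps (timed_filter p xs) = 1 + (\<Sum>x\<leftarrow>xs. 1 + steps (p x))"
  by (induction xs) auto

lemma result_timed_concat_map:
  "result (timed_concat_map f xs) = concat (map (\<lambda>x. result (f x)) xs)"
  by (induction xs) auto

lemma steps_timed_concat_map:
  "steps (timed_concat_map f xs) = 1 + (\<Sum>x\<leftarrow>xs. 1 + steps (f x) + length (result (f x)))"
  by (induction xs) auto

section \<open>Words and prefixes\<close>

text \<open>Distinct elements of \<open>A\<close> give distinct powers of two, so the sum has no
  carries and equals a bitwise or. The element 0 is excluded because truncated subtraction would put
  it on the bit of 1.\<close>

lemma bit_word_rep:
  assumes "finite A" "A \<subseteq> {1..}"
  shows "bit (word_rep A) m \<longleftrightarrow> Suc m \<in> A"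
  using assms
proof (induction A arbitrary: m rule: finite_induct)
  case empty
  then show ?case by (simp add: word_rep_def)
next
  case (insert a A)
  have IH: "bit (word_rep A) m \<longleftrightarrow> Suc m \<in> A" for m
    using insert by auto
  have bit_a: "bit (2 ^ (a - 1) :: nat) m \<longleftrightarrow> Suc m = a" for m
    using insert.prems by (auto simp: bit_exp_iff)
  have "word_rep (insert a A) = 2 ^ (a - 1) + word_rep A"
    using insert by (simp add: word_rep_def)
  also have "\<dots> = Bit_Operations.or (2 ^ (a - 1)) (word_rep A)"
    using insert.hyps IH bit_a by (intro disjunctive_add_eq_or bit_eqI) (auto simp: bit_and_iff)
  finally show ?case
    by (simp only: bit_or_iff IH bit_a insert_iff)
qed

lemma set_word_elems: "set (word_elems w W) = {y \<in> {1..w}. bit W (y - 1)}"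
  by (auto simp: word_elems_def)

lemma distinct_word_elems: "distinct (word_elems w W)"
  by (simp add: word_elems_def)

lemma top_bits_less:
  assumes "t \<le> t'" "z < 2 ^ t'"
  shows "top_bits t t' z < 2 ^ t"
proof -
  have "z < 2 ^ t * 2 ^ (t' - t)"
    using assms by (simp add: power_add [symmetric])
  then show ?thesis
    by (simp add: top_bits_def drop_bit_eq_div less_mult_imp_div_less)
qed

lemma top_bits_top_bits:
  assumes "t \<le> t'" "t' \<le> t''"
  shows "top_bits t t' (top_bits t' t'' z) = top_bits t t'' z"
  using assms by (simp add: top_bits_def)

lemma top_bits_same [simp]: "top_bits t t z = z"
  by (simp add: top_bits_def)

section \<open>A single run\<close>

text \<open>The number of sets in which \<open>x\<close> survives when \<open>L\<^sub>i, L\<^bsub>i-1\<^esub>, \<dots>, L\<^sub>1\<close> are intersected in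
  this order.\<close>

primrec depth :: "(nat \<Rightarrow> 'a set) \<Rightarrow> nat \<Rightarrow> 'a \<Rightarrow> nat" where
  "depth L 0 x = 0"
| "depth L (Suc i) x = (if x \<in> L (Suc i) then Suc (depth L i x) else 0)"

lemma depth_le: "depth L i x \<le> i"
  by (induction i) auto

lemma depth_le_card: "depth L i x \<le> (\<Sum>j=1..i. of_bool (x \<in> L j))"
  by (induction i) auto

lemma UN_fibres: "f ` A \<subseteq> B \<Longrightarrow> (\<Union>z\<in>B. {x \<in> A. f x = z}) = A"
  by blast

text \<open>For \<open>x\<close> outside \<open>A\<close> this is a simultaneous collision of
  \<open>x\<close> with an element of \<open>A\<close> under the prefix of \<open>g\<close> and
  under \<open>h\<close>. With \<open>g\<close> and \<open>h\<close> as arguments it can serve as a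
  random event.\<close>

definition meets :: "nat \<Rightarrow> nat set \<Rightarrow> (nat \<Rightarrow> nat) \<Rightarrow> (nat \<Rightarrow> nat) \<Rightarrow> nat \<Rightarrow> bool" where
  "meets w A g h x \<longleftrightarrow> (let t = nat (partition_bits w (card A)) in
     h x \<in> h ` {x' \<in> A. top_bits t w (g x') = top_bits t w (g x)})"

text \<open>One fixed outcome of the hash functions. \<open>bits_mono\<close> makes the strings of
  smaller sets prefixes of those of larger ones, and \<open>bits_le\<close> keeps the subtraction in
  \<open>top_bits\<close> from truncating.\<close>

locale hashed_sets =
  fixes w k :: nat and L :: "nat \<Rightarrow> nat set" and g h key :: "nat \<Rightarrow> nat"
  assumes k_pos: "k \<ge> 1"
    and finite_L: "\<And>i. i \<in> {1..k} \<Longrightarrow> finite (L i)"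
    and g_less: "\<And>i x. i \<in> {1..k} \<Longrightarrow> x \<in> L i \<Longrightarrow> g x < 2 ^ w"
    and h_range: "\<And>i x. i \<in> {1..k} \<Longrightarrow> x \<in> L i \<Longrightarrow> h x \<in> {1..w}"
    and bits_le: "\<And>i. i \<in> {1..k} \<Longrightarrow> nat (partition_bits w (card (L i))) \<le> w"
    and bits_mono: "\<And>i j. i \<in> {1..k} \<Longrightarrow> j \<in> {1..k} \<Longrightarrow> i \<le> j \<Longrightarrow>
      nat (partition_bits w (card (L i))) \<le> nat (partition_bits w (card (L j)))"
begin

definition t :: "nat \<Rightarrow> nat" where
  "t i = nat (partition_bits w (card (L i)))"

definition prefix :: "nat \<Rightarrow> nat \<Rightarrow> nat" where
  "prefix i x = top_bits (t i) w (g x)"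

definition D :: preprocessed where
  "D = preprocess w key L g h"

text \<open>The set whose word representation the algorithm enumerates for the string \<open>z\<close> of
  length \<open>t\<^sub>j\<close>.\<close>

definition common_hashes :: "nat \<Rightarrow> nat \<Rightarrow> nat set" where
  "common_hashes j z =
     {y. \<forall>i\<in>{1..j}. y \<in> h ` {x \<in> L i. prefix i x = top_bits (t i) (t j) z}}"

text \<open>Exactly the elements of \<open>L k\<close> that the run lists from inverted mappings:
  the hash value of \<open>x\<close> survives the bitwise AND for the group of
  \<open>x\<close>.\<close>

definition visited :: "nat set" where
  "visited = {x \<in> L k. \<forall>i\<in>{1..k}. h x \<in> h ` {x' \<in> L i. prefix i x' = prefix i x}}"

section \<open>Stored data and group strings\<close>

lemma len_D [simp]: "len D i = t i"
  by (simp add: D_def preprocess_def t_def Let_def)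

lemma hash_word_D: "hash_word D i z = word_rep (h ` {x \<in> L i. prefix i x = z})"
  by (simp add: D_def preprocess_def t_def Let_def hash_group_def prefix_def)

lemma inverted_D:
  "inverted D i z y = sort_key key (sorted_list_of_set {x \<in> L i. prefix i x = z \<and> h x = y})"
  by (simp add: D_def preprocess_def t_def Let_def hash_group_def prefix_def conj_assoc)

lemma set_inverted:
  "i \<in> {1..k} \<Longrightarrow> set (inverted D i z y) = {x \<in> L i. prefix i x = z \<and> h x = y}"
  using finite_L by (simp add: inverted_D)

lemma distinct_inverted: "distinct (inverted D i z y)"
  by (simp add: inverted_D)

lemma t_mono: "i \<in> {1..k} \<Longrightarrow> j \<in> {1..k} \<Longrightarrow> i \<le> j \<Longrightarrow> t i \<le> t j"
  unfolding t_def by (rule bits_mono)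

lemma t_le: "i \<in> {1..k} \<Longrightarrow> t i \<le> w"
  unfolding t_def by (rule bits_le)

lemma prefix_less: "i \<in> {1..k} \<Longrightarrow> x \<in> L i \<Longrightarrow> prefix i x < 2 ^ t i"
  unfolding prefix_def by (intro top_bits_less t_le g_less)

lemma top_bits_prefix:
  "i \<in> {1..k} \<Longrightarrow> j \<in> {1..k} \<Longrightarrow> i \<le> j \<Longrightarrow> top_bits (t i) (t j) (prefix j x) = prefix i x"
  unfolding prefix_def by (intro top_bits_top_bits t_mono t_le)

section \<open>The table of word intersections\<close>

lemma bit_hash_word:
  assumes "i \<in> {1..k}"
  shows "bit (hash_word D i z) m \<longleftrightarrow> Suc m \<in> h ` {x \<in> L i. prefix i x = z}"
  unfolding hash_word_D using h_range [OF assms] finite_L [OF assms]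
  by (intro bit_word_rep) force+

text \<open>Entry \<open>z\<close> combines the hash word of group \<open>z\<close> with the entry
  for its shorter prefix, and prefixes of prefixes compose. Bit \<open>m\<close> stands for the hash
  value \<open>Suc m\<close>.\<close>

lemma bit_and_table:
  "j \<in> {1..k} \<Longrightarrow> z < 2 ^ t j \<Longrightarrow>
    bit (result (and_table D j) ! z) m \<longleftrightarrow> Suc m \<in> common_hashes j z"
proof (induction j arbitrary: z)
  case 0
  then show ?case by simp
next
  case (Suc j)
  show ?case
  proof (cases j)
    case 0
    then show ?thesis
      using Suc.prems by (simp add: result_timed_map bit_hash_word common_hashes_def)
  next
    case (Suc j')
    let ?z = "top_bits (t j) (t (Suc j)) z"
    have j: "j \<in> {1..k}" "Suc j \<in> {1..k}"
      using Suc Suc.prems by auto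
    have "?z < 2 ^ t j"
      using j Suc.prems by (intro top_bits_less t_mono) auto
    then have "bit (result (and_table D j) ! ?z) m \<longleftrightarrow> Suc m \<in> common_hashes j ?z"
      using j by (intro Suc.IH)
    moreover have "top_bits (t i) (t j) ?z = top_bits (t i) (t (Suc j)) z" if "i \<in> {1..j}" for i
      using j that by (intro top_bits_top_bits t_mono) auto
    moreover have "{1..Suc j} = insert (Suc j) {1..j}"
      by auto
    ultimately show ?thesis
      using Suc Suc.prems j
      by (simp add: result_timed_map bit_and_iff bit_hash_word common_hashes_def conj_commute)
  qed
qed

lemma steps_and_table: "j \<le> k \<Longrightarrow> steps (and_table D j) \<le> 6 * (\<Sum>i=1..j. 2 ^ t i)"
proof (induction j)
  case 0
  then show ?case by simp
next
  case (Suc j)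
  \<comment> \<open>Each entry costs at most four primitives and one loop step. The 1 for ending the
    loop is then absorbed because the table is nonempty, hence the factor 6.\<close>
  have "steps (and_table D (Suc j)) \<le> steps (and_table D j) + (1 + 5 * 2 ^ t (Suc j))"
    by (cases j) (auto simp: steps_timed_map sum_list_triv)
  also have "1 + 5 * 2 ^ t (Suc j) \<le> (6::nat) * 2 ^ t (Suc j)"
    by simp
  finally show ?case
    using Suc by simp
qed

lemma set_word_elems_and_table:
  assumes "z < 2 ^ t k"
  shows "set (word_elems w (result (and_table D k) ! z)) = common_hashes k z"
proof -
  \<comment> \<open>The range excludes \<open>y = 0\<close>, for which \<open>y - 1\<close> would
    read the bit belonging to 1.\<close>
  have "common_hashes k z \<subseteq> {1..w}"
    using h_range [of k] k_pos unfolding common_hashes_def by fastforce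
  then have "y \<in> {1..w} \<and> bit (result (and_table D k) ! z) (y - 1) \<longleftrightarrow> y \<in> common_hashes k z" for y
    using bit_and_table [of k z "y - 1"] assms k_pos by (cases y) auto
  then show ?thesis
    by (auto simp only: set_word_elems mem_Collect_eq Collect_conj_eq)
qed

section \<open>Descending intersection of inverted mappings\<close>

lemma result_intersect_down:
  assumes "i \<le> k" "\<And>x. x \<in> set P \<Longrightarrow> prefix k x = z \<and> h x = y"
  shows "result (intersect_down D k z y i P) = filter (\<lambda>x. \<forall>j\<in>{1..i}. x \<in> L j) P"
  using assms
proof (induction i arbitrary: P)
  case 0
  then show ?case by simp
next
  case (Suc i)
  let ?z = "top_bits (t (Suc i)) (t k) z"
  \<comment> \<open>The string looked up for set \<open>Suc i\<close> is the one that
    \<open>x\<close> itself has there, and \<open>h x = y\<close>, so the hash-table query decides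
    membership in \<open>L (Suc i)\<close>.\<close>
  have mem: "x \<in> set (inverted D (Suc i) ?z y) \<longleftrightarrow> x \<in> L (Suc i)" if "x \<in> set P" for x
    using top_bits_prefix [of "Suc i" k x] Suc.prems that by (auto simp: set_inverted)
  have "{1..Suc i} = insert (Suc i) {1..i}"
    by auto
  then show ?case
    using Suc.IH [of "filter (\<lambda>x. x \<in> L (Suc i)) P"] Suc.prems mem
    by (simp add: hash_intersect_def result_timed_filter conj_commute cong: filter_cong)
qed

text \<open>Filtering a nonempty \<open>P\<close> costs
  \<open>2 + 2 * length P \<le> 4 * length P\<close>, and an empty one ends the recursion. Each
  \<open>x\<close> occurs in \<open>Suc (depth L i x)\<close> of the successive lists: the initial
  one and one per survived set.\<close>

lemma steps_intersect_down:
  assumes "i \<le> k" "\<And>x. x \<in> set P \<Longrightarrow> prefix k x = z \<and> h x = y"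
  shows "steps (intersect_down D k z y i P) \<le> 1 + 4 * (\<Sum>x\<leftarrow>P. Suc (depth L i x))"
  using assms
proof (induction i arbitrary: P)
  case 0
  then show ?case by simp
next
  case (Suc i)
  let ?z = "top_bits (t (Suc i)) (t k) z"
  let ?P = "filter (\<lambda>x. x \<in> L (Suc i)) P"
  have mem: "x \<in> set (inverted D (Suc i) ?z y) \<longleftrightarrow> x \<in> L (Suc i)" if "x \<in> set P" for x
    using top_bits_prefix [of "Suc i" k x] Suc.prems that by (auto simp: set_inverted)
  have IH: "steps (intersect_down D k z y i ?P) \<le> 1 + 4 * (\<Sum>x\<leftarrow>?P. Suc (depth L i x))"
    using Suc.prems by (intro Suc.IH) auto
  have depth_Suc: "(\<Sum>x\<leftarrow>P. Suc (depth L (Suc i) x)) =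
      length P + (\<Sum>x\<leftarrow>?P. Suc (depth L i x))"
    by (induction P) auto
  show ?case
  proof (cases "P = []")
    case False
    then have "length P \<ge> 1"
      by (cases P) auto
    then show ?thesis
      using IH False mem unfolding depth_Suc
      by (simp add: hash_intersect_def result_timed_filter steps_timed_filter sum_list_triv
          cong: filter_cong)
  qed simp
qed

section \<open>Charging the work of a group to visited elements\<close>

lemma prefix_mem_common_hashes_iff:
  assumes "x \<in> L k"
  shows "h x \<in> common_hashes k (prefix k x) \<longleftrightarrow> x \<in> visited"
proof -
  have "top_bits (t i) (t k) (prefix k x) = prefix i x" if "i \<in> {1..k}" for i
    using that by (intro top_bits_prefix) auto
  then show ?thesis
    using assms by (simp add: common_hashes_def visited_def)
qed

text \<open>Every enumerated hash value is backed by a listed element, which pays for the constant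
  overhead spent on that value.\<close>

lemma common_hashes_inverted_ne:
  assumes "y \<in> common_hashes k z"
  shows "{x \<in> L k. prefix k x = z \<and> h x = y} \<noteq> {}"
proof -
  have "y \<in> h ` {x \<in> L k. prefix k x = top_bits (t k) (t k) z}"
    using assms k_pos unfolding common_hashes_def by (auto simp only: mem_Collect_eq Ball_def atLeastAtMost_iff)
  then show ?thesis
    by auto
qed

text \<open>The charge of group \<open>z\<close>. A visited element lies in \<open>L k\<close>, so
  it contributes at least 1.\<close>

definition cost :: "nat \<Rightarrow> nat" where
  "cost z = (\<Sum>x | x \<in> visited \<and> prefix k x = z. depth L k x)"

lemma finite_visited: "finite visited"
  using finite_L [of k] k_pos by (simp add: visited_def)

lemma sum_cost: "(\<Sum>z<2 ^ t k. cost z) = (\<Sum>x\<in>visited. depth L k x)"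
proof -
  have "prefix k ` visited \<subseteq> {..<2 ^ t k}"
    using k_pos prefix_less [of k] by (auto simp: visited_def)
  then show ?thesis
    unfolding cost_def using finite_visited by (intro sum.group) auto
qed

text \<open>Regroups the charge by hash value to match the loop over \<open>y\<close>: for an
  enumerated \<open>y\<close>, every element of the group with that hash value is visited.\<close>

lemma cost_eq:
  "cost z = (\<Sum>y\<in>common_hashes k z. \<Sum>x | x \<in> L k \<and> prefix k x = z \<and> h x = y. depth L k x)"
proof -
  have eq: "{x \<in> {x. x \<in> visited \<and> prefix k x = z}. h x = y} =
      {x. x \<in> L k \<and> prefix k x = z \<and> h x = y}" if "y \<in> common_hashes k z" for y
    using that prefix_mem_common_hashes_iff by (auto simp: visited_def)
  have "finite (common_hashes k z)"
    using finite_L [of k] k_pos by (rule_tac finite_subset [of _ "h ` L k"])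
      (auto simp: common_hashes_def)
  then have "cost z = (\<Sum>y\<in>common_hashes k z.
      \<Sum>x | x \<in> {x. x \<in> visited \<and> prefix k x = z} \<and> h x = y. depth L k x)"
    unfolding cost_def
  proof (intro sum.group [symmetric])
    show "finite {x. x \<in> visited \<and> prefix k x = z}"
      using finite_visited by simp
    show "h ` {x. x \<in> visited \<and> prefix k x = z} \<subseteq> common_hashes k z"
      using prefix_mem_common_hashes_iff by (auto simp: visited_def)
  qed
  also have "\<dots> = (\<Sum>y\<in>common_hashes k z.
      \<Sum>x | x \<in> L k \<and> prefix k x = z \<and> h x = y. depth L k x)"
    by (intro sum.cong eq refl)
  finally show ?thesis .
qed

lemma visited_if_common:
  "x \<in> (\<Inter>i\<in>{1..k}. L i) \<Longrightarrow> x \<in> visited"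
  using k_pos by (force simp: visited_def)

context
  fixes z W
  assumes z: "z < 2 ^ t k" and W: "W = result (and_table D k) ! z"
begin

lemma result_group_hash:
  "result (intersect_down D k z y (k - 1) (inverted D k z y)) =
    filter (\<lambda>x. \<forall>j\<in>{1..k}. x \<in> L j) (inverted D k z y)"
proof -
  have inv: "x \<in> set (inverted D k z y) \<longleftrightarrow> x \<in> L k \<and> prefix k x = z \<and> h x = y" for x
    using k_pos by (simp add: set_inverted)
  have "j \<in> {1..k} \<longleftrightarrow> j = k \<or> j \<in> {1..k - 1}" for j
    using k_pos by auto
  then have eq: "(\<forall>j\<in>{1..k - 1}. x \<in> L j) \<longleftrightarrow> (\<forall>j\<in>{1..k}. x \<in> L j)" if "x \<in> L k" for x
    using that by metis
  have "result (intersect_down D k z y (k - 1) (inverted D k z y)) =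
      filter (\<lambda>x. \<forall>j\<in>{1..k - 1}. x \<in> L j) (inverted D k z y)"
    using inv by (intro result_intersect_down) auto
  also have "\<dots> = filter (\<lambda>x. \<forall>j\<in>{1..k}. x \<in> L j) (inverted D k z y)"
    using inv eq by (intro filter_cong) blast+
  finally show ?thesis .
qed

lemma steps_group_hash:
  "steps (intersect_down D k z y (k - 1) (inverted D k z y)) \<le>
    1 + 4 * (\<Sum>x | x \<in> L k \<and> prefix k x = z \<and> h x = y. depth L k x)"
proof -
  have "steps (intersect_down D k z y (k - 1) (inverted D k z y)) \<le>
      1 + 4 * (\<Sum>x\<leftarrow>inverted D k z y. Suc (depth L (k - 1) x))"
    using k_pos set_inverted [of k z y] by (intro steps_intersect_down) auto
  also have "(\<Sum>x\<leftarrow>inverted D k z y. Suc (depth L (k - 1) x)) =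
      (\<Sum>x | x \<in> L k \<and> prefix k x = z \<and> h x = y. Suc (depth L (k - 1) x))"
    using k_pos by (simp add: sum_list_distinct_conv_sum_set distinct_inverted set_inverted)
  \<comment> \<open>Since \<open>x \<in> L k\<close>, \<open>depth L k x\<close> unfolds to exactly
    \<open>Suc (depth L (k - 1) x)\<close>.\<close>
  also have "\<dots> = (\<Sum>x | x \<in> L k \<and> prefix k x = z \<and> h x = y. depth L k x)"
    using k_pos by (intro sum.cong) (auto simp: gr0_conv_Suc Suc_le_eq)
  finally show ?thesis .
qed

lemma length_inverted_le:
  "length (inverted D k z y) \<le> (\<Sum>x | x \<in> L k \<and> prefix k x = z \<and> h x = y. depth L k x)"
proof -
  have "length (inverted D k z y) = (\<Sum>x | x \<in> L k \<and> prefix k x = z \<and> h x = y. 1)"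
    using k_pos distinct_card [OF distinct_inverted, of k z y] by (simp add: set_inverted)
  also have "\<dots> \<le> (\<Sum>x | x \<in> L k \<and> prefix k x = z \<and> h x = y. depth L k x)"
    using k_pos by (intro sum_mono) (auto simp: gr0_conv_Suc Suc_le_eq)
  finally show ?thesis .
qed

lemma set_result_group:
  "set (result (intersect_groups w D k z W)) = {x \<in> (\<Inter>i\<in>{1..k}. L i). prefix k x = z}"
proof -
  have mem: "h x \<in> common_hashes k (prefix k x)" if "x \<in> (\<Inter>i\<in>{1..k}. L i)" for x
    using that k_pos prefix_mem_common_hashes_iff [of x] visited_if_common [of x] by auto
  have "set (result (intersect_groups w D k z W)) = (\<Union>y\<in>common_hashes k z.
      set (filter (\<lambda>x. \<forall>j\<in>{1..k}. x \<in> L j) (inverted D k z y)))"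
    by (simp add: intersect_groups_def result_timed_concat_map result_group_hash
        set_word_elems_and_table [OF z] W del: One_nat_def)
  also have "\<dots> = (\<Union>y\<in>common_hashes k z.
      {x \<in> (\<Inter>i\<in>{1..k}. L i). prefix k x = z \<and> h x = y})"
    using k_pos by (intro SUP_cong) (auto simp: set_inverted)
  also have "\<dots> = {x \<in> (\<Inter>i\<in>{1..k}. L i). prefix k x = z}"
    using mem by blast
  finally show ?thesis .
qed

lemma distinct_result_group: "distinct (result (intersect_groups w D k z W))"
proof -
  let ?f = "\<lambda>y. filter (\<lambda>x. \<forall>j\<in>{1..k}. x \<in> L j) (inverted D k z y)"
  have "distinct (concat (map ?f ys))" if "distinct ys" for ys
    using that k_pos by (induction ys) (auto simp: distinct_inverted set_inverted)
  then show ?thesis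
    using distinct_word_elems
    by (simp add: intersect_groups_def result_timed_concat_map result_group_hash del: One_nat_def)
qed

lemma steps_group: "steps (intersect_groups w D k z W) \<le> 2 + 10 * cost z"
  and length_result_group: "length (result (intersect_groups w D k z W)) \<le> cost z"
proof -
  let ?ys = "word_elems w W"
  let ?c = "\<lambda>y. \<Sum>x | x \<in> L k \<and> prefix k x = z \<and> h x = y. depth L k x"
  have ys: "set ?ys = common_hashes k z"
    using set_word_elems_and_table [OF z] by (simp add: W)
  have cost: "cost z = (\<Sum>y\<leftarrow>?ys. ?c y)"
    by (simp add: cost_eq sum_list_distinct_conv_sum_set distinct_word_elems ys)
  have c_pos: "1 \<le> ?c y" if "y \<in> set ?ys" for y
  proof -
    have "length (inverted D k z y) \<noteq> 0"
      using that common_hashes_inverted_ne [of y z] k_pos set_inverted [of k z y]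
      by (auto simp: ys)
    then show ?thesis
      using length_inverted_le [of y] by linarith
  qed
  have length: "length (result (intersect_down D k z y (k - 1) (inverted D k z y))) \<le>
      length (inverted D k z y)" for y
    by (simp add: result_group_hash del: One_nat_def)
  have "length (result (intersect_groups w D k z W)) =
      (\<Sum>y\<leftarrow>?ys. length (result (intersect_down D k z y (k - 1) (inverted D k z y))))"
    by (simp add: intersect_groups_def result_timed_concat_map length_concat o_def)
  also have "\<dots> \<le> (\<Sum>y\<leftarrow>?ys. ?c y)"
    using length length_inverted_le by (intro sum_list_mono) (meson order_trans)
  finally show "length (result (intersect_groups w D k z W)) \<le> cost z"
    by (simp add: cost)
  have "steps (intersect_groups w D k z W) = 2 + length ?ys + (\<Sum>y\<leftarrow>?ys. 2 +
      length (inverted D k z y) + steps (intersect_down D k z y (k - 1) (inverted D k z y)) +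
      length (result (intersect_down D k z y (k - 1) (inverted D k z y))))"
    by (simp add: intersect_groups_def steps_timed_concat_map add.assoc)
  \<comment> \<open>The cost \<open>length ?ys\<close> of listing the word becomes one further unit
    per hash value.\<close>
  also have "\<dots> = 2 + (\<Sum>y\<leftarrow>?ys. 3 +
      length (inverted D k z y) + steps (intersect_down D k z y (k - 1) (inverted D k z y)) +
      length (result (intersect_down D k z y (k - 1) (inverted D k z y))))"
    by (simp only: sum_list_addf sum_list_triv) simp
  \<comment> \<open>With \<open>c = ?c y\<close> the summand is at most
    \<open>3 + c + (1 + 4 * c) + c = 4 + 6 * c\<close>, and \<open>c \<ge> 1\<close> turns this into
    \<open>10 * c\<close>.\<close>
  also have "\<dots> \<le> 2 + (\<Sum>y\<leftarrow>?ys. 10 * ?c y)"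
  proof (intro add_left_mono sum_list_mono)
    fix y assume "y \<in> set ?ys"
    then show "3 +
      length (inverted D k z y) + steps (intersect_down D k z y (k - 1) (inverted D k z y)) +
      length (result (intersect_down D k z y (k - 1) (inverted D k z y))) \<le> 10 * ?c y"
      using c_pos [of y] steps_group_hash [of y] length_inverted_le [of y] length [of y]
      by linarith
  qed
  finally show "steps (intersect_groups w D k z W) \<le> 2 + 10 * cost z"
    by (simp only: cost sum_list_const_mult)
qed

end

section \<open>Correctness and cost of the whole run\<close>

lemma set_result_intersect_sets:
  "set (result (intersect_sets w D k)) = (\<Inter>i\<in>{1..k}. L i)"
proof -
  let ?T = "result (and_table D k)"
  have "set (result (intersect_sets w D k)) =
      (\<Union>z<2 ^ t k. set (result (intersect_groups w D k z (?T ! z))))"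
    by (simp add: intersect_sets_def result_timed_concat_map atLeast0LessThan)
  also have "\<dots> = (\<Union>z<2 ^ t k. {x \<in> (\<Inter>i\<in>{1..k}. L i). prefix k x = z})"
    by (intro SUP_cong set_result_group) auto
  also have "\<dots> = (\<Inter>i\<in>{1..k}. L i)"
  proof (rule UN_fibres)
    show "prefix k ` (\<Inter>i\<in>{1..k}. L i) \<subseteq> {..<2 ^ t k}"
      using k_pos prefix_less [of k] by auto
  qed
  finally show ?thesis .
qed

lemma distinct_result_intersect_sets: "distinct (result (intersect_sets w D k))"
proof -
  let ?T = "result (and_table D k)"
  let ?f = "\<lambda>z. result (intersect_groups w D k z (?T ! z))"
  have set: "set (?f z) = {x \<in> (\<Inter>i\<in>{1..k}. L i). prefix k x = z}"
    and dist: "distinct (?f z)" if "z < 2 ^ t k" for z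
    using that by (simp_all only: set_result_group distinct_result_group)
  have "distinct (concat (map ?f [0..<m]))" if "m \<le> 2 ^ t k" for m
    using that
  proof (induction m)
    case (Suc m)
    have "set (?f z) \<inter> set (?f m) = {}" if "z < m" for z
      using that Suc.prems set [of z] set [of m] by force
    then have "(\<Union>z<m. set (?f z)) \<inter> set (?f m) = {}"
      by blast
    then show ?case
      using Suc dist [of m] by (simp add: atLeast0LessThan)
  qed simp
  then show ?thesis
    by (simp add: intersect_sets_def result_timed_concat_map)
qed

lemma steps_intersect_sets:
  "steps (intersect_sets w D k) \<le> 11 * (\<Sum>i=1..k. 2 ^ t i) + 11 * (\<Sum>x\<in>visited. depth L k x)"
proof -
  let ?T = "result (and_table D k)"
  have "steps (intersect_sets w D k) = steps (and_table D k) + 1 +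
      (\<Sum>z<2 ^ t k. 2 + steps (intersect_groups w D k z (?T ! z)) +
        length (result (intersect_groups w D k z (?T ! z))))"
    by (simp add: intersect_sets_def steps_timed_concat_map sum_list_distinct_conv_sum_set
        atLeast0LessThan)
  \<comment> \<open>Each string has overhead 2 + 2, and appending its output adds one
    \<open>cost z\<close> to the ten from its group.\<close>
  also have "\<dots> \<le> 6 * (\<Sum>i=1..k. 2 ^ t i) + 1 + (\<Sum>z<2 ^ t k. 4 + 11 * cost z)"
  proof (rule add_mono [OF add_right_mono])
    show "steps (and_table D k) \<le> 6 * (\<Sum>i=1..k. 2 ^ t i)"
      by (intro steps_and_table) simp
    show "(\<Sum>z<2 ^ t k. 2 + steps (intersect_groups w D k z (?T ! z)) +
        length (result (intersect_groups w D k z (?T ! z)))) \<le> (\<Sum>z<2 ^ t k. 4 + 11 * cost z)"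
    proof (rule sum_mono)
      fix z :: nat assume "z \<in> {..<2 ^ t k}"
      then show "2 + steps (intersect_groups w D k z (?T ! z)) +
          length (result (intersect_groups w D k z (?T ! z))) \<le> 4 + 11 * cost z"
        using steps_group [of z "?T ! z"] length_result_group [of z "?T ! z"] by simp
    qed
  qed
  also have "\<dots> = 6 * (\<Sum>i=1..k. 2 ^ t i) + (1 + 4 * 2 ^ t k) + 11 * (\<Sum>x\<in>visited. depth L k x)"
    by (simp only: sum.distrib sum_distrib_left [symmetric] sum_cost sum_constant) simp
  \<comment> \<open>\<open>2 ^ t k\<close> is one term of the sum, so the overhead of all strings
    joins the table cost, giving 6 + 5 = 11.\<close>
  also have "1 + 4 * 2 ^ t k \<le> 5 * (\<Sum>i=1..k. (2::nat) ^ t i)"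
  proof -
    have "2 ^ t k \<le> (\<Sum>i=1..k. (2::nat) ^ t i)"
      using k_pos by (intro member_le_sum) auto
    moreover have "(1::nat) \<le> 2 ^ t k" by simp
    ultimately show ?thesis by linarith
  qed
  finally show ?thesis by linarith
qed

lemma result_run:
  "set (result (intersect_sets w (preprocess w key L g h) k)) = (\<Inter>i\<in>{1..k}. L i)"
  "distinct (result (intersect_sets w (preprocess w key L g h) k))"
  using set_result_intersect_sets distinct_result_intersect_sets by (simp_all only: D_def)

text \<open>Expressing \<open>visited\<close> through \<open>of_bool\<close> leaves a sum over the
  fixed set \<open>L k\<close> in which only the events depend on \<open>g\<close> and
  \<open>h\<close>.\<close>

lemma steps_run:
  "steps (intersect_sets w (preprocess w key L g h) k) \<le>
    11 * (\<Sum>i=1..k. 2 ^ nat (partition_bits w (card (L i)))) +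
    11 * (\<Sum>x\<in>L k. depth L k x * of_bool (\<forall>i\<in>{1..k}. meets w (L i) g h x))"
proof -
  have "visited = {x \<in> L k. \<forall>i\<in>{1..k}. meets w (L i) g h x}"
    by (simp add: visited_def meets_def prefix_def t_def Let_def)
  moreover have "finite (L k)"
    using finite_L k_pos by simp
  ultimately have "(\<Sum>x\<in>visited. depth L k x) =
      (\<Sum>x\<in>L k. depth L k x * of_bool (\<forall>i\<in>{1..k}. meets w (L i) g h x))"
    by (simp only: sum.inter_filter) (simp add: of_bool_def if_distrib cong: if_cong)
  then show ?thesis
    using steps_intersect_sets by (simp only: D_def t_def)
qed

end

section \<open>Collision probabilities\<close>

lemma card_top_bits_fibre_le:
  "card {b \<in> {..<2 ^ w}. top_bits t w b = z} \<le> 2 ^ (w - t)"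
proof -
  \<comment> \<open>Fixing the quotient by \<open>2 ^ (w - t)\<close> confines \<open>b\<close> to a
    block of that many consecutive numbers.\<close>
  have "{b \<in> {..<2 ^ w}. top_bits t w b = z} \<subseteq> {z * 2 ^ (w - t)..<z * 2 ^ (w - t) + 2 ^ (w - t)}"
  proof
    fix b assume "b \<in> {b \<in> {..<2 ^ w}. top_bits t w b = z}"
    then have "b div 2 ^ (w - t) = z"
      by (simp add: top_bits_def drop_bit_eq_div)
    then have "b = z * 2 ^ (w - t) + b mod 2 ^ (w - t)"
      using div_mult_mod_eq [of b "2 ^ (w - t)"] by simp
    moreover have "b mod 2 ^ (w - t) < 2 ^ (w - t)"
      by simp
    ultimately show "b \<in> {z * 2 ^ (w - t)..<z * 2 ^ (w - t) + 2 ^ (w - t)}"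
      unfolding atLeastLessThan_iff by linarith
  qed
  from card_mono [OF _ this] show ?thesis by simp
qed

lemma pair_pmf_of_set:
  assumes "finite A" "A \<noteq> {}" "finite B" "B \<noteq> {}"
  shows "pair_pmf (pmf_of_set A) (pmf_of_set B) = pmf_of_set (A \<times> B)"
proof (rule pmf_eqI)
  fix x
  show "pmf (pair_pmf (pmf_of_set A) (pmf_of_set B)) x = pmf (pmf_of_set (A \<times> B)) x"
    using assms by (cases x) (simp add: pmf_pair indicator_times card_cartesian_product)
qed

text \<open>The pair \<open>(g x, g x')\<close> is uniform on the square, and each \<open>a\<close>
  has at most \<open>2 ^ (w - t)\<close> partners \<open>b\<close> among
  \<open>2 ^ w\<close>.\<close>

lemma pairwise_independent_collision:
  assumes G: "pairwise_independent_family U w G" and x: "x \<in> U" "x' \<in> U" "x \<noteq> x'" and t: "t \<le> w"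
  shows "measure_pmf.prob G {g. top_bits t w (g x') = top_bits t w (g x)} \<le> 1 / 2 ^ t"
proof -
  let ?A = "{..<2 ^ w} :: nat set" and ?R = "\<lambda>a b. top_bits t w b = top_bits t w a"
  have A: "?A \<noteq> {}" "finite ?A"
    by (auto simp: lessThan_empty_iff)
  have "measure_pmf.prob G {g. ?R (g x) (g x')} =
      measure_pmf.prob (map_pmf (\<lambda>g. (g x, g x')) G) {(a, b). ?R a b}"
    by (simp add: vimage_def)
  also have "map_pmf (\<lambda>g. (g x, g x')) G = pmf_of_set (?A \<times> ?A)"
    using G x A by (simp add: pairwise_independent_family_def pair_pmf_of_set)
  also have "measure_pmf.prob (pmf_of_set (?A \<times> ?A)) {(a, b). ?R a b} =
      real (card ((?A \<times> ?A) \<inter> {(a, b). ?R a b})) / real (card (?A \<times> ?A))"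
    using A by (subst measure_pmf_of_set) auto
  also have "(?A \<times> ?A) \<inter> {(a, b). ?R a b} = (SIGMA a:?A. {b \<in> ?A. ?R a b})"
    by auto
  also have "real (card (SIGMA a:?A. {b \<in> ?A. ?R a b})) / real (card (?A \<times> ?A)) \<le>
      real (2 ^ w * 2 ^ (w - t)) / real (card (?A \<times> ?A))"
  proof (intro divide_right_mono of_nat_mono)
    have "card (SIGMA a:?A. {b \<in> ?A. ?R a b}) = (\<Sum>a\<in>?A. card {b \<in> ?A. ?R a b})"
      by (intro card_SigmaI) auto
    also have "\<dots> \<le> (\<Sum>a\<in>?A. 2 ^ (w - t))"
      by (intro sum_mono card_top_bits_fibre_le)
    finally show "card (SIGMA a:?A. {b \<in> ?A. ?R a b}) \<le> 2 ^ w * 2 ^ (w - t)"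
      by simp
  qed simp
  also have "\<dots> = 1 / 2 ^ t"
    using t by (simp add: card_cartesian_product field_simps flip: power_add)
  finally show ?thesis .
qed

text \<open>Double counting pairs of a permutation and some \<open>y \<noteq> x\<close> bounds the
  probability by \<open>(2 ^ (w - t) - 1) / (2 ^ w - 1)\<close>, which is at most
  \<open>1 / 2 ^ t\<close>.\<close>

lemma random_permutation_collision:
  assumes G: "random_permutation U w G" and x: "x \<in> U" "x' \<in> U" "x \<noteq> x'" and t: "t \<le> w"
  shows "measure_pmf.prob G {g. top_bits t w (g x') = top_bits t w (g x)} \<le> 1 / 2 ^ t"
proof -
  let ?P = "{g. g permutes U}" and ?m = "2 ^ (w - t) :: nat"
  let ?R = "\<lambda>g y. top_bits t w (g y) = top_bits t w (g x)"
  let ?c = "card {g \<in> ?P. ?R g x'}"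
  have U: "U = {..<2 ^ w}" and G_eq: "G = pmf_of_set ?P"
    using G by (auto simp: random_permutation_def)
  have "finite U" "card U = 2 ^ w"
    by (simp_all add: U)
  have P: "finite ?P" "?P \<noteq> {}"
    using finite_permutations [OF \<open>finite U\<close>] permutes_id [of U] by blast+
  \<comment> \<open>All \<open>y \<noteq> x\<close> collide with \<open>x\<close> equally often, and for a fixed permutation only \<open>?m - 1\<close> of
    them do.\<close>
  have c_eq: "card {g \<in> ?P. ?R g y} = ?c" if y: "y \<in> U - {x}" for y
  proof (rule bij_betw_same_card)
    let ?\<tau> = "Transposition.transpose x' y"
    have "g \<circ> ?\<tau> permutes U" if "g permutes U" for g
      using x y that by (intro permutes_compose permutes_swap_id) auto
    moreover have "?\<tau> x = x" "?\<tau> x' = y" "?\<tau> y = x'"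
      using x y by (auto simp: Transposition.transpose_def)
    \<comment> \<open>Precomposition with the transposition is its own inverse, keeps the value at
      \<open>x\<close> and exchanges those at \<open>x'\<close> and \<open>y\<close>.\<close>
    ultimately show "bij_betw (\<lambda>g. g \<circ> ?\<tau>) {g \<in> ?P. ?R g y} {g \<in> ?P. ?R g x'}"
      by (intro bij_betwI [where g = "\<lambda>g. g \<circ> ?\<tau>"]) (simp_all add: o_assoc [symmetric])
  qed
  have "(2 ^ w - 1) * ?c = (\<Sum>y\<in>U - {x}. ?c)"
    using x \<open>finite U\<close> \<open>card U = 2 ^ w\<close> by simp
  also have "\<dots> = (\<Sum>y\<in>U - {x}. card {g \<in> ?P. ?R g y})"
    by (intro sum.cong refl c_eq [symmetric])
  also have "\<dots> = (\<Sum>g\<in>?P. card {y \<in> U - {x}. ?R g y})"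
    using sum.swap_restrict [of "U - {x}" ?P "\<lambda>_ _. 1 :: nat" "\<lambda>y g. ?R g y"] \<open>finite U\<close> P
    by simp
  also have "\<dots> \<le> (\<Sum>g\<in>?P. ?m - 1)"
  proof (rule sum_mono)
    fix g assume "g \<in> ?P"
    then have g: "g permutes U" by simp
    have "card {y \<in> U. ?R g y} = card (g ` {y \<in> U. ?R g y})"
      by (intro card_image [symmetric] permutes_inj_on [OF g])
    also have "\<dots> \<le> card {b \<in> {..<2 ^ w}. top_bits t w b = top_bits t w (g x)}"
      using permutes_in_image [OF g] by (intro card_mono) (auto simp: U)
    also have "\<dots> \<le> ?m"
      by (rule card_top_bits_fibre_le)
    finally have "card {y \<in> U. ?R g y} \<le> ?m" .
    moreover have "{y \<in> U - {x}. ?R g y} = {y \<in> U. ?R g y} - {x}"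
      by auto
    ultimately show "card {y \<in> U - {x}. ?R g y} \<le> ?m - 1"
      using x \<open>finite U\<close> by simp
  qed
  finally have le: "(2 ^ w - 1) * ?c \<le> card ?P * (?m - 1)"
    by simp
  \<comment> \<open>\<open>U\<close> contains the distinct elements \<open>x\<close> and
    \<open>x'\<close>, so \<open>2 ^ w - 1\<close> is positive and can be cancelled later.\<close>
  have w: "2 \<le> (2::nat) ^ w"
    using x card_mono [of U "{x, x'}"] \<open>finite U\<close> \<open>card U = 2 ^ w\<close> by simp
  have "real (2 ^ w - 1) * real ?c \<le> real (card ?P) * real (?m - 1)"
    using le by (simp only: of_nat_mult [symmetric] of_nat_le_iff)
  then have le': "(2 ^ w - 1) * real ?c \<le> card ?P * (real ?m - 1)"
    by (simp add: of_nat_diff)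
  have "real ?m \<le> 2 ^ w"
    by (simp add: power_increasing)
  \<comment> \<open>This is \<open>(m - 1) / (N - 1) \<le> m / N\<close> for
    \<open>m \<le> N = 2 ^ w\<close>, with denominators cleared.\<close>
  then have "2 ^ w * (real ?m - 1) \<le> (2 ^ w - 1) * real ?m"
    by (simp add: algebra_simps)
  have "(2 ^ w - 1) * (2 ^ w * real ?c) = 2 ^ w * ((2 ^ w - 1) * real ?c)"
    by simp
  also have "\<dots> \<le> 2 ^ w * (card ?P * (real ?m - 1))"
    using le' by (intro mult_left_mono) auto
  also have "\<dots> = card ?P * (2 ^ w * (real ?m - 1))"
    by simp
  also have "\<dots> \<le> card ?P * ((2 ^ w - 1) * real ?m)"
    by (intro mult_left_mono) (fact, simp)
  also have "\<dots> = (2 ^ w - 1) * (card ?P * real ?m)"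
    by simp
  finally have "2 ^ w * real ?c \<le> card ?P * real ?m"
  proof (rule mult_left_le_imp_le)
    show "0 < 2 ^ w - (1::real)"
      using w by (metis diff_gt_0_iff_gt less_le_trans of_nat_1 of_nat_less_iff of_nat_numeral
          of_nat_power one_less_numeral_iff semiring_norm(76))
  qed
  moreover have "(2::real) ^ w = 2 ^ t * real ?m"
    using t by (simp flip: power_add)
  ultimately have "real ?m * (2 ^ t * real ?c) \<le> real ?m * real (card ?P)"
    by (simp only: ac_simps)
  then have "2 ^ t * real ?c \<le> real (card ?P)"
    by (rule mult_left_le_imp_le) simp
  moreover have "real (card ?P) > 0"
    using P by (simp add: card_gt_0_iff)
  ultimately have "real ?c / real (card ?P) \<le> 1 / 2 ^ t"
    by (simp only: divide_le_eq le_divide_eq) (simp add: field_simps)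
  moreover have "measure_pmf.prob G {g. ?R g x'} = ?c / card ?P"
    unfolding G_eq using P by (simp add: measure_pmf_of_set Collect_conj_eq)
  ultimately show ?thesis
    by (simp only:)
qed

section \<open>Independent events and the choice of the number of bits\<close>

lemma prob_pair_pmf_Times:
  "measure_pmf.prob (pair_pmf M N) (A \<times> B) = measure_pmf.prob M A * measure_pmf.prob N B"
proof -
  \<comment> \<open>Cutting down to the supports makes both factors countable, as the product rule
    requires.\<close>
  have "measure_pmf.prob (pair_pmf M N) (A \<times> B) =
      measure_pmf.prob (pair_pmf M N) ((A \<inter> set_pmf M) \<times> (B \<inter> set_pmf N))"
    by (intro measure_pmf.finite_measure_eq_AE) (auto simp: AE_measure_pmf_iff)
  also have "\<dots> = measure_pmf.prob M (A \<inter> set_pmf M) * measure_pmf.prob N (B \<inter> set_pmf N)"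
    by (intro measure_pmf_prob_product) auto
  finally show ?thesis
    by (simp add: measure_Int_set_pmf)
qed

text \<open>Nonnegativity keeps \<open>nat\<close> from truncating, and rounding up costs at most a
  factor 2. The lower bound on the number of strings controls collisions, the upper bound the cost
  of the tables.\<close>

lemma partition_bits_bounds:
  assumes "m > 0" "w \<ge> 1" "partition_bits w m \<ge> 0"
  shows "real m / sqrt (real w) \<le> 2 ^ nat (partition_bits w m)"
    and "2 ^ nat (partition_bits w m) \<le> 2 * (real m / sqrt (real w))"
proof -
  let ?v = "real m / sqrt (real w)"
  have v: "?v > 0"
    using assms by simp
  have pow: "2 ^ nat (partition_bits w m) = 2 powr real_of_int (partition_bits w m)"
    using assms(3) by (simp flip: powr_realpow)
  have "?v = 2 powr log 2 ?v"
    using v by simp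
  also have "\<dots> \<le> 2 powr real_of_int (partition_bits w m)"
    by (intro powr_mono) (auto simp: partition_bits_def)
  finally show "?v \<le> 2 ^ nat (partition_bits w m)"
    by (simp only: pow)
  have "real_of_int (partition_bits w m) \<le> 1 + log 2 ?v"
    unfolding partition_bits_def by linarith
  then have "2 powr real_of_int (partition_bits w m) \<le> 2 powr (1 + log 2 ?v)"
    by (intro powr_mono) auto
  also have "\<dots> = 2 * ?v"
    using v by (simp only: powr_add) simp
  finally show "2 ^ nat (partition_bits w m) \<le> 2 * ?v"
    by (simp only: pow)
qed

lemma partition_bits_mono:
  assumes "0 < m" "m \<le> m'" "w \<ge> 1"
  shows "partition_bits w m \<le> partition_bits w m'"
  unfolding partition_bits_def using assms by (intro ceiling_mono) (simp add: divide_right_mono)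

lemma partition_bits_le:
  assumes "0 < m" "m \<le> 2 ^ w" "w \<ge> 1"
  shows "nat (partition_bits w m) \<le> w"
proof -
  have "real m / sqrt (real w) \<le> real m / 1"
    using assms by (intro divide_left_mono) auto
  also have "\<dots> \<le> 2 ^ w"
    using assms by (simp flip: of_nat_le_iff)
  finally have "log 2 (real m / sqrt (real w)) \<le> log 2 (2 ^ w)"
    using assms by (subst log_le_cancel_iff) auto
  then show ?thesis
    unfolding partition_bits_def by (simp add: ceiling_le_iff)
qed

text \<open>Union bound over \<open>A\<close>: as \<open>x \<notin> A\<close>, each of its elements
  differs from \<open>x\<close>, and independence of \<open>g\<close> and \<open>h\<close>
  multiplies the bounds \<open>1 / 2 ^ t\<close> and \<open>1 / w\<close>.\<close>

lemma prob_meets_le: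
  assumes G: "pairwise_independent_family U w G \<or> random_permutation U w G"
    and H: "universal_family U w H"
    and U: "U \<subseteq> {..<2 ^ w}" and w: "w \<ge> 1"
    and A: "A \<subseteq> U" "A \<noteq> {}" "partition_bits w (card A) \<ge> 0"
    and x: "x \<in> U" "x \<notin> A"
  shows "measure_pmf.prob (pair_pmf G H) {(g, h). meets w A g h x} \<le> 1 / sqrt (real w)"
proof -
  define t where "t = nat (partition_bits w (card A))"
  have "finite A"
    using A U by (meson finite_lessThan finite_subset)
  then have card_A: "card A > 0"
    using A by (simp add: card_gt_0_iff)
  have "card A \<le> 2 ^ w"
    using card_mono [of "{..<2 ^ w}" A] A U by (simp add: subset_trans [of A U])
  then have t: "t \<le> w"
    unfolding t_def using card_A w by (intro partition_bits_le)
  have coll: "measure_pmf.prob G {g. top_bits t w (g x') = top_bits t w (g x)} \<le> 1 / 2 ^ t"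
    if "x' \<in> A" for x'
    using G that x A t pairwise_independent_collision random_permutation_collision by blast
  have "measure_pmf.prob (pair_pmf G H) {(g, h). meets w A g h x} \<le> measure_pmf.prob (pair_pmf G H)
      (\<Union>x'\<in>A. {g. top_bits t w (g x') = top_bits t w (g x)} \<times> {h. h x = h x'})"
    by (intro measure_pmf.finite_measure_mono) (auto simp: meets_def t_def Let_def)
  also have "\<dots> \<le> (\<Sum>x'\<in>A. measure_pmf.prob (pair_pmf G H)
      ({g. top_bits t w (g x') = top_bits t w (g x)} \<times> {h. h x = h x'}))"
    using \<open>finite A\<close> by (intro measure_pmf.finite_measure_subadditive_finite) auto
  also have "\<dots> \<le> (\<Sum>x'\<in>A. 1 / 2 ^ t * (1 / real w))"
  proof (rule sum_mono)
    fix x' assume x': "x' \<in> A"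
    have "x' \<in> U" "x \<noteq> x'"
      using x' x A by auto
    then have "measure_pmf.prob H {h. h x = h x'} \<le> 1 / real w"
      using H x unfolding universal_family_def by simp
    then show "measure_pmf.prob (pair_pmf G H)
        ({g. top_bits t w (g x') = top_bits t w (g x)} \<times> {h. h x = h x'}) \<le> 1 / 2 ^ t * (1 / real w)"
      unfolding prob_pair_pmf_Times using coll [OF x'] by (intro mult_mono) auto
  qed
  also have "\<dots> = real (card A) / 2 ^ t / real w"
    by simp
  \<comment> \<open>The choice of \<open>t\<close> enters here, as
    \<open>card A / sqrt w \<le> 2 ^ t\<close>.\<close>
  also have "\<dots> \<le> sqrt (real w) / real w"
    using partition_bits_bounds(1) [OF card_A w A(3)] w
    by (intro divide_right_mono) (auto simp: t_def field_simps)
  also have "\<dots> = 1 / sqrt (real w)"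
    using w by (simp add: field_simps)
  finally show ?thesis .
qed

text \<open>Passes from the families to each outcome in the support: \<open>g x\<close> stays below
  \<open>2 ^ w\<close> because it is uniform on that range, or because a permutation maps
  \<open>U\<close> to itself.\<close>

lemma hashed_sets_if_families:
  assumes w: "w \<ge> 1" and U: "U \<subseteq> {..<2 ^ w}"
    and G: "pairwise_independent_family U w G \<or> random_permutation U w G"
    and H: "universal_family U w H" and k: "k \<ge> 1"
    and L: "\<forall>i\<in>{1..k}. L i \<subseteq> U \<and> L i \<noteq> {} \<and> partition_bits w (card (L i)) \<ge> 0"
    and mono: "\<forall>i\<in>{1..k}. \<forall>j\<in>{1..k}. i \<le> j \<longrightarrow> card (L i) \<le> card (L j)"
    and gh: "g \<in> set_pmf G" "h \<in> set_pmf H"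
  shows "hashed_sets w k L g h"
proof
  have fin: "finite (L i)" "card (L i) > 0" "card (L i) \<le> 2 ^ w" if "i \<in> {1..k}" for i
  proof -
    have "L i \<subseteq> U" and ne: "L i \<noteq> {}"
      using bspec [OF L that] by simp_all
    then have sub: "L i \<subseteq> {..<2 ^ w}"
      using U by (rule_tac subset_trans)
    show "finite (L i)"
      using sub by (rule finite_subset) simp
    then show "card (L i) > 0"
      using ne by (simp add: card_gt_0_iff)
    show "card (L i) \<le> 2 ^ w"
      using card_mono [OF _ sub] by simp
  qed
  have g: "g x < 2 ^ w" if "x \<in> U" for x
    using G
  proof
    assume "pairwise_independent_family U w G"
    then have "g x \<in> set_pmf (pmf_of_set {..<2 ^ w})"
      using that gh imageI [of g "set_pmf G" "\<lambda>g. g x"]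
      by (simp add: pairwise_independent_family_def flip: set_map_pmf)
    then show ?thesis
      by (simp add: lessThan_empty_iff)
  next
    assume perm: "random_permutation U w G"
    then have "finite {g. g permutes U}"
      by (intro finite_permutations) (simp add: random_permutation_def)
    moreover have "{g. g permutes U} \<noteq> {}"
      using permutes_id by blast
    ultimately have "g permutes U"
      using perm gh by (simp add: random_permutation_def set_pmf_of_set)
    then show ?thesis
      using that perm permutes_in_image [of g U x] by (simp add: random_permutation_def)
  qed
  show "k \<ge> 1" by fact
  fix i assume i: "i \<in> {1..k}"
  show "finite (L i)"
    using fin i by simp
  show "nat (partition_bits w (card (L i))) \<le> w"
    using fin i w by (intro partition_bits_le) auto
  show "nat (partition_bits w (card (L i))) \<le> nat (partition_bits w (card (L j)))"
    if "j \<in> {1..k}" "i \<le> j" for j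
    using that fin i w mono by (intro nat_mono partition_bits_mono) auto
  fix x assume "x \<in> L i"
  then have "x \<in> U"
    using L i by auto
  then show "g x < 2 ^ w" "h x \<in> {1..w}"
    using g gh H unfolding universal_family_def by auto
qed

text \<open>After exchanging the sums, set \<open>i\<close> contributes
  \<open>card (L i \<inter> L k)\<close>. Bounding each depth by \<open>k\<close> instead would give
  \<open>k * card (L k)\<close>, which may exceed the total size.\<close>

lemma sum_depth_le:
  assumes "\<And>i. i \<in> {1..k} \<Longrightarrow> finite (L i)" "k \<ge> 1"
  shows "(\<Sum>x\<in>L k. depth L k x) \<le> (\<Sum>i=1..k. card (L i))"
proof -
  have "(\<Sum>x\<in>L k. depth L k x) \<le> (\<Sum>x\<in>L k. \<Sum>i=1..k. of_bool (x \<in> L i))"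
    by (intro sum_mono depth_le_card)
  also have "\<dots> = (\<Sum>i=1..k. \<Sum>x\<in>L k. of_bool (x \<in> L i))"
    by (rule sum.swap)
  also have "\<dots> \<le> (\<Sum>i=1..k. card (L i))"
  proof (rule sum_mono)
    fix i assume "i \<in> {1..k}"
    then have "finite (L i)" "finite (L k)"
      using assms by auto
    then show "(\<Sum>x\<in>L k. of_bool (x \<in> L i)) \<le> card (L i)"
      using card_mono [OF _ Int_lower2, of "L i" "L k"] by (simp add: of_bool_def sum.If_cases Int_def)
  qed
  finally show ?thesis .
qed

section \<open>Expected running time over \<open>g\<close> and \<open>h\<close>\<close>

theorem theorem3p7:
  shows "\<exists>C::real. \<forall>(w::nat) (U::nat set) (k::nat) (L::nat \<Rightarrow> nat set)
      (G::(nat \<Rightarrow> nat) pmf) (H::(nat \<Rightarrow> nat) pmf) (key::nat \<Rightarrow> nat).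
    w \<ge> 1 \<longrightarrow> U \<subseteq> {..<2 ^ w} \<longrightarrow> inj_on key U \<longrightarrow>
    pairwise_independent_family U w G \<or> random_permutation U w G \<longrightarrow>
    universal_family U w H \<longrightarrow>
    k \<ge> 1 \<longrightarrow>
    (\<forall>i\<in>{1..k}. L i \<subseteq> U \<and> L i \<noteq> {} \<and> partition_bits w (card (L i)) \<ge> 0) \<longrightarrow>
    (\<forall>i\<in>{1..k}. \<forall>j\<in>{1..k}. i \<le> j \<longrightarrow> card (L i) \<le> card (L j)) \<longrightarrow>
    (let n = (\<Sum>i=1..k. card (L i));
         r = card (\<Inter>i\<in>{1..k}. L i);
         run = (\<lambda>(g, h). intersect_sets w (preprocess w key L g h) k);
         M = measure_pmf (pair_pmf G H)
     in (\<forall>\<omega>\<in>set_pmf (pair_pmf G H).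
           set (result (run \<omega>)) = (\<Inter>i\<in>{1..k}. L i) \<and> distinct (result (run \<omega>))) \<and>
        integrable M (\<lambda>\<omega>. real (steps (run \<omega>))) \<and>
        (\<integral>\<omega>. real (steps (run \<omega>)) \<partial>M) \<le> C * (real n / sqrt (real w) + real k * real r))"
\<comment> \<open>The tables contribute 11 * 2 = 22 times \<open>n / sqrt w\<close> and the
  collisions another 11; the \<open>k * r\<close> term has factor 11.\<close>
proof (intro exI [of _ 33] allI impI)
  fix w :: nat and U :: "nat set" and k :: nat and L :: "nat \<Rightarrow> nat set"
    and G H :: "(nat \<Rightarrow> nat) pmf" and key :: "nat \<Rightarrow> nat"
  assume w: "w \<ge> 1" and U: "U \<subseteq> {..<2 ^ w}" and "inj_on key U"
    and G: "pairwise_independent_family U w G \<or> random_permutation U w G"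
    and H: "universal_family U w H" and k: "k \<ge> 1"
    and L: "\<forall>i\<in>{1..k}. L i \<subseteq> U \<and> L i \<noteq> {} \<and> partition_bits w (card (L i)) \<ge> 0"
    and mono: "\<forall>i\<in>{1..k}. \<forall>j\<in>{1..k}. i \<le> j \<longrightarrow> card (L i) \<le> card (L j)"
  define n where "n = (\<Sum>i=1..k. card (L i))"
  define I where "I = (\<Inter>i\<in>{1..k}. L i)"
  define run where "run = (\<lambda>(g, h). intersect_sets w (preprocess w key L g h) k)"
  define M where "M = measure_pmf (pair_pmf G H)"
  define T where "T = (\<Sum>i=1..k. 2 ^ nat (partition_bits w (card (L i))) :: nat)"
  define E where "E x = {(g, h). \<forall>i\<in>{1..k}. meets w (L i) g h x}" for x
  \<comment> \<open>A majorant of the step count on the support. It is linear in the indicators of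
    the events \<open>E x\<close>, so its expectation follows from their probabilities
    alone.\<close>
  define F where "F \<omega> = 11 * real T + 11 * (\<Sum>x\<in>L k. real (depth L k x) * indicator (E x) \<omega>)" for \<omega>
  have fin: "finite (L i)" if "i \<in> {1..k}" for i
    using L U that by (meson finite_lessThan finite_subset)
  have hashed: "hashed_sets w k L g h" if "(g, h) \<in> set_pmf (pair_pmf G H)" for g h
    using hashed_sets_if_families [OF w U G H k L mono] that by simp
  have correct: "set (result (run \<omega>)) = I \<and> distinct (result (run \<omega>))"
    if "\<omega> \<in> set_pmf (pair_pmf G H)" for \<omega>
    using that hashed_sets.result_run [OF hashed] unfolding run_def I_def by (cases \<omega>) auto
  have steps_le: "real (steps (run \<omega>)) \<le> F \<omega>" if "\<omega> \<in> set_pmf (pair_pmf G H)" for \<omega>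
  proof (cases \<omega>)
    case (Pair g h)
    have "real (steps (run \<omega>)) \<le> real (11 * T +
        11 * (\<Sum>x\<in>L k. depth L k x * of_bool (\<forall>i\<in>{1..k}. meets w (L i) g h x)))"
      using hashed_sets.steps_run [OF hashed, of g h key] that
      unfolding Pair run_def T_def by (simp only: of_nat_le_iff prod.case)
    also have "\<dots> = F \<omega>"
      by (simp add: F_def Pair E_def indicator_def of_bool_def if_distrib cong: if_cong)
    finally show ?thesis .
  qed
  have F_le: "F \<omega> \<le> 11 * real T + 11 * (\<Sum>x\<in>L k. real (depth L k x))" for \<omega>
    unfolding F_def by (intro add_left_mono mult_left_mono sum_mono) (auto simp: indicator_def)
  have "real (steps (run \<omega>)) \<le> 11 * real T + 11 * (\<Sum>x\<in>L k. real (depth L k x))"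
    if "\<omega> \<in> set_pmf (pair_pmf G H)" for \<omega>
    using steps_le [OF that] F_le [of \<omega>] by linarith
  then have int_steps: "integrable M (\<lambda>\<omega>. real (steps (run \<omega>)))"
    unfolding M_def by (intro measure_pmf.integrable_const_bound
        [where B = "11 * real T + 11 * (\<Sum>x\<in>L k. real (depth L k x))"])
      (auto simp: AE_measure_pmf_iff)
  have int_E: "integrable M (indicator (E x) :: _ \<Rightarrow> real)" for x
    unfolding M_def by (intro measure_pmf.integrable_const_bound [where B = 1]) auto
  have int_F: "integrable M F"
    using int_E unfolding M_def F_def by (intro Bochner_Integration.integrable_add
        integrable_mult_right Bochner_Integration.integrable_sum) auto
  have "(\<integral>\<omega>. real (steps (run \<omega>)) \<partial>M) \<le> (\<integral>\<omega>. F \<omega> \<partial>M)"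
    using int_steps int_F steps_le unfolding M_def
    by (intro integral_mono_AE) (auto simp: AE_measure_pmf_iff)
  also have "\<dots> = 11 * real T + 11 * (\<Sum>x\<in>L k. real (depth L k x) * measure M (E x))"
    using int_E unfolding M_def F_def by simp
  \<comment> \<open>Elements of the intersection are estimated by depth at most \<open>k\<close> and
    probability at most 1; the others keep their depth as the weight of the collision bound.\<close>
  also have "(\<Sum>x\<in>L k. real (depth L k x) * measure M (E x)) \<le>
      (\<Sum>x\<in>L k. real k * indicator I x + real (depth L k x) / sqrt (real w))"
  proof (rule sum_mono)
    fix x assume x: "x \<in> L k"
    show "real (depth L k x) * measure M (E x) \<le>
        real k * indicator I x + real (depth L k x) / sqrt (real w)"
    proof (cases "x \<in> I")
      case True
      have "real (depth L k x) * measure M (E x) \<le> real k * 1"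
        unfolding M_def by (intro mult_mono) (auto simp: depth_le)
      then show ?thesis
        using True by (simp add: add_increasing2)
    next
      case False
      then obtain i where i: "i \<in> {1..k}" "x \<notin> L i"
        by (auto simp: I_def)
      have "x \<in> U"
        using x L k by auto
      \<comment> \<open>One set missing \<open>x\<close> suffices: \<open>E x\<close> asks
        \<open>x\<close> to meet every set, in particular \<open>L i\<close>.\<close>
      have "measure M (E x) \<le> measure M {(g, h). meets w (L i) g h x}"
        unfolding M_def E_def using i by (intro measure_pmf.finite_measure_mono) auto
      also have "\<dots> \<le> 1 / sqrt (real w)"
        unfolding M_def using L i \<open>x \<in> U\<close> by (intro prob_meets_le [OF G H U w]) auto
      finally have "real (depth L k x) * measure M (E x) \<le> real (depth L k x) * (1 / sqrt (real w))"
        by (intro mult_left_mono) auto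
      then show ?thesis
        using False by simp
    qed
  qed
  also have "\<dots> = real k * real (card I) + real (\<Sum>x\<in>L k. depth L k x) / sqrt (real w)"
  proof -
    have "{x \<in> L k. x \<in> I} = I"
      using k by (auto simp: I_def)
    then have "(\<Sum>x\<in>L k. indicator I x) = real (card I)"
      using fin [of k] k by (simp add: indicator_def sum.If_cases Int_def)
    then show ?thesis
      by (simp add: sum.distrib sum_divide_distrib flip: sum_distrib_left)
  qed
  also have "\<dots> \<le> real k * real (card I) + real n / sqrt (real w)"
    using sum_depth_le [OF fin k] unfolding n_def
    by (intro add_left_mono divide_right_mono of_nat_mono) auto
  finally have "(\<integral>\<omega>. real (steps (run \<omega>)) \<partial>M) \<le>
      11 * real T + 11 * (real k * real (card I) + real n / sqrt (real w))"
    by simp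
  moreover have "real T \<le> 2 * (real n / sqrt (real w))"
  proof -
    have "real T = (\<Sum>i=1..k. 2 ^ nat (partition_bits w (card (L i))))"
      by (simp add: T_def)
    also have "\<dots> \<le> (\<Sum>i=1..k. 2 * (real (card (L i)) / sqrt (real w)))"
      using L fin w by (intro sum_mono partition_bits_bounds) (auto simp: card_gt_0_iff)
    also have "\<dots> = 2 * (real n / sqrt (real w))"
      by (simp add: n_def sum_distrib_left sum_divide_distrib)
    finally show ?thesis .
  qed
  moreover have "0 \<le> real k * real (card I)"
    by simp
  ultimately have "(\<integral>\<omega>. real (steps (run \<omega>)) \<partial>M) \<le>
      33 * (real n / sqrt (real w) + real k * real (card I))"
    unfolding distrib_left by linarith
  with correct int_steps
  show "let n = (\<Sum>i=1..k. card (L i));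
         r = card (\<Inter>i\<in>{1..k}. L i);
         run = (\<lambda>(g, h). intersect_sets w (preprocess w key L g h) k);
         M = measure_pmf (pair_pmf G H)
     in (\<forall>\<omega>\<in>set_pmf (pair_pmf G H).
           set (result (run \<omega>)) = (\<Inter>i\<in>{1..k}. L i) \<and> distinct (result (run \<omega>))) \<and>
        integrable M (\<lambda>\<omega>. real (steps (run \<omega>))) \<and>
        (\<integral>\<omega>. real (steps (run \<omega>)) \<partial>M) \<le> 33 * (real n / sqrt (real w) + real k * real r)"
    unfolding Let_def n_def I_def run_def M_def by blast
qed

end
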